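(* Let $(X_t)_{t\ge0}$ be an ergodic Markov chain on a countable state space $\mathcal X$ with transition matrix $P=(P_{i,j})_{i,j\in\mathcal X}$ and stationary distribution $\pi=(\pi_i)_{i\in\mathcal X}$, and fix $i\in\mathcal X$. Let $T_{\pi,i}$ be a random variable with the law of $\inf\{t\ge0:X_t=i\}$ when $\mathcal L(X_0)=\pi$, and let $T_{i,i}$ be a random variable with the law of $\inf\{t>0:X_t=i\}$ when $X_0=i$, where $T_{\pi,i}$ and $T_{i,i}$ are defined on the same probability space with an arbitrary joint distribution. Then $$d_{\mathrm K}(\mathcal L(\pi_iT_{\pi,i}),\mathrm{Exp}(1))\le 2\pi_i+\min\bigl\{\pi_i\,\mathbb{E}|T_{\pi,i}-T_{i,i}|,\ \mathbb{P}(T_{\pi,i}\ne T_{i,i})\bigr\}.$$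
   Context: $\mathcal{L}(X)$ denotes the law of $X$; $\mathrm{Exp}(1)$ is the exponential distribution with mean $1$; $d_{\mathrm K}(P,Q)=\sup_{z\in\mathbb{R}}|P((-\infty,z])-Q((-\infty,z])|$ is the Kolmogorov distance. The Markov chain is in discrete time and time-homogeneous; ergodic means in particular irreducible and positive recurrent, so $\pi$ is unique and $\pi_i>0$. *)

theory Defs
  imports "HOL-Probability.Probability"
begin

definition transition_matrix :: "('a \<Rightarrow> 'a \<Rightarrow> real) \<Rightarrow> bool" where
  "transition_matrix P \<longleftrightarrow> (\<forall>i j. 0 \<le> P i j) \<and> (\<forall>i. (P i has_sum 1) UNIV)"

fun n_step :: "('a \<Rightarrow> 'a \<Rightarrow> real) \<Rightarrow> nat \<Rightarrow> 'a \<Rightarrow> 'a \<Rightarrow> real" where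
  "n_step P 0 i j = (if i = j then 1 else 0)"
| "n_step P (Suc n) i j = (\<Sum>\<^sub>\<infinity>k. P i k * n_step P n k j)"

definition irreducible_chain :: "('a \<Rightarrow> 'a \<Rightarrow> real) \<Rightarrow> bool" where
  "irreducible_chain P \<longleftrightarrow> (\<forall>i j. \<exists>n. n_step P n i j > 0)"

text \<open>\<open>first_passage P n i j\<close> is the probability that the chain started in \<open>i\<close> visits \<open>j\<close>
  at time \<open>n\<close> for the first time after time \<open>0\<close>.\<close>

fun first_passage :: "('a \<Rightarrow> 'a \<Rightarrow> real) \<Rightarrow> nat \<Rightarrow> 'a \<Rightarrow> 'a \<Rightarrow> real" where
  "first_passage P 0 i j = 0"
| "first_passage P (Suc 0) i j = P i j"
| "first_passage P (Suc (Suc n)) i j =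
     (\<Sum>\<^sub>\<infinity>k\<in>UNIV - {j}. P i k * first_passage P (Suc n) k j)"

text \<open>The return time is almost surely finite and has finite mean.\<close>

definition positive_recurrent :: "('a \<Rightarrow> 'a \<Rightarrow> real) \<Rightarrow> 'a \<Rightarrow> bool" where
  "positive_recurrent P i \<longleftrightarrow>
     (\<lambda>n. first_passage P n i i) sums 1 \<and> summable (\<lambda>n. real n * first_passage P n i i)"

text \<open>Aperiodicity is deliberately not required.\<close>

definition ergodic_chain :: "('a \<Rightarrow> 'a \<Rightarrow> real) \<Rightarrow> bool" where
  "ergodic_chain P \<longleftrightarrow> irreducible_chain P \<and> (\<forall>i. positive_recurrent P i)"

definition stationary_distribution :: "('a \<Rightarrow> real) \<Rightarrow> ('a \<Rightarrow> 'a \<Rightarrow> real) \<Rightarrow> bool" where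
  "stationary_distribution \<pi> P \<longleftrightarrow>
     (\<forall>i. 0 \<le> \<pi> i) \<and> (\<pi> has_sum 1) UNIV \<and> (\<forall>j. ((\<lambda>i. \<pi> i * P i j) has_sum \<pi> j) UNIV)"

definition markov_chain ::
  "'w measure \<Rightarrow> (nat \<Rightarrow> 'w \<Rightarrow> 'a) \<Rightarrow> ('a \<Rightarrow> 'a \<Rightarrow> real) \<Rightarrow> bool" where
  "markov_chain M X P \<longleftrightarrow>
     prob_space M \<and> (\<forall>t. X t \<in> measurable M (count_space UNIV)) \<and>
     (\<forall>n x j. \<P>(\<omega> in M. \<forall>t\<le>n. X t \<omega> = x t) > 0 \<longrightarrow>
        \<P>(\<omega> in M. X (Suc n) \<omega> = j \<bar> \<forall>t\<le>n. X t \<omega> = x t) = P (x n) j)"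

text \<open>In both definitions the infimum of the empty set is \<open>\<infinity>\<close>.\<close>

definition hitting_time :: "(nat \<Rightarrow> 'w \<Rightarrow> 'a) \<Rightarrow> 'a \<Rightarrow> 'w \<Rightarrow> ereal" where
  "hitting_time X i \<omega> = (INF t\<in>{t. X t \<omega> = i}. ereal (real t))"

definition return_time :: "(nat \<Rightarrow> 'w \<Rightarrow> 'a) \<Rightarrow> 'a \<Rightarrow> 'w \<Rightarrow> ereal" where
  "return_time X i \<omega> = (INF t\<in>{t. t > 0 \<and> X t \<omega> = i}. ereal (real t))"

definition kolmogorov_distance :: "real measure \<Rightarrow> real measure \<Rightarrow> real" where
  "kolmogorov_distance P Q = (SUP z. \<bar>measure P {..z} - measure Q {..z}\<bar>)"

definition exponential_law :: "real \<Rightarrow> real measure" where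
  "exponential_law l = density lborel (\<lambda>x. ennreal (exponential_density l x))"

end

theory Submission
  imports Defs
begin

text \<open>
  Let \<open>S\<close> and \<open>T\<close> be the hitting time of \<open>i\<close> from stationarity and the return time to \<open>i\<close>, and write
  \<open>p\<close> for \<open>\<pi> i\<close>. Stationarity gives \<open>\<P>(S = n) = p * \<P>(T > n)\<close>. Hence, with
  \<open>a n = \<P>(S \<ge> n)\<close> and \<open>h n = \<P>(S > n) - \<P>(T > n)\<close>, the recursion
  \<open>(1 + p) * a (n + 1) = a n + p * h n\<close> holds, so \<open>a n\<close> differs from \<open>(1 + p) ^ (- n)\<close> by at most
  \<open>sup \<bar>h\<bar> \<le> \<P>(S \<noteq> T)\<close> and by at most \<open>p * \<Sum> \<bar>h\<bar> \<le> p * \<E>\<bar>S - T\<bar>\<close>. Replacing \<open>(1 + p) ^ (- n)\<close> by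
  the exponential tail costs another \<open>2 * p\<close>. Positivity of \<open>p\<close> is forced by \<open>S\<close> being finite.
\<close>

section \<open>Probabilities of constrained paths\<close>

text \<open>The constraint sets depend on time so that free starts, prescribed starts and avoidance
  of a state are all instances. Recording the end state makes the Markov property a recursion in
  \<open>n\<close>; values in \<open>ennreal\<close> keep the sums over states free of summability
  conditions.\<close>

definition path_prob ::
  "'w measure \<Rightarrow> (nat \<Rightarrow> 'w \<Rightarrow> 'a) \<Rightarrow> (nat \<Rightarrow> 'a set) \<Rightarrow> nat \<Rightarrow> 'a \<Rightarrow> ennreal" where
  "path_prob M X A n k = emeasure M {\<omega> \<in> space M. (\<forall>t\<le>n. X t \<omega> \<in> A t) \<and> X n \<omega> = k}"

lemma markov_chain_measurable:
  "markov_chain M X P \<Longrightarrow> X t \<in> measurable M (count_space UNIV)"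
  by (simp add: markov_chain_def)

text \<open>For a path of positive probability this is the conditional probability in
  \<open>markov_chain\<close> multiplied out. For a null path both sides vanish, so no case
  distinction is left for the users of the lemma.\<close>

lemma markov_chain_path_step:
  assumes "transition_matrix P" and chain: "markov_chain M X P"
  shows "emeasure M {\<omega> \<in> space M. (\<forall>t\<le>n. X t \<omega> = x t) \<and> X (Suc n) \<omega> = k} =
    emeasure M {\<omega> \<in> space M. \<forall>t\<le>n. X t \<omega> = x t} * ennreal (P (x n) k)"
proof -
  interpret prob_space M using chain by (simp add: markov_chain_def)
  have [measurable]: "\<And>t. X t \<in> measurable M (count_space UNIV)"
    using chain by (rule markov_chain_measurable)
  define A where "A = {\<omega> \<in> space M. \<forall>t\<le>n. X t \<omega> = x t}"
  define B where "B = {\<omega> \<in> space M. (\<forall>t\<le>n. X t \<omega> = x t) \<and> X (Suc n) \<omega> = k}"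
  have [measurable]: "A \<in> sets M" "B \<in> sets M" unfolding A_def B_def by measurable
  have "prob B = prob A * P (x n) k"
  proof (cases "prob A > 0")
    case True
    then have "\<P>(\<omega> in M. X (Suc n) \<omega> = k \<bar> \<forall>t\<le>n. X t \<omega> = x t) = P (x n) k"
      using chain unfolding markov_chain_def A_def by blast
    moreover have "{\<omega> \<in> space M. X (Suc n) \<omega> = k \<and> (\<forall>t\<le>n. X t \<omega> = x t)} = B"
      by (auto simp: B_def)
    ultimately show ?thesis
      using True unfolding cond_prob_def A_def[symmetric] by (simp add: field_simps)
  next
    case False
    then have "prob A = 0" by (simp add: zero_less_measure_iff)
    moreover have "prob B \<le> prob A"
      by (rule finite_measure_mono) (auto simp: A_def B_def)
    ultimately show ?thesis by (simp add: measure_le_0_iff)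
  qed
  then have "emeasure M B = emeasure M A * ennreal (P (x n) k)"
    using \<open>transition_matrix P\<close>
    by (simp add: emeasure_eq_measure transition_matrix_def flip: ennreal_mult)
  then show ?thesis by (simp only: A_def B_def)
qed

text \<open>Forward equation of the chain killed outside \<open>A\<close>: the event is split into
  countably many single trajectories, and the factor of the last step depends on a trajectory only
  through its end state \<open>j\<close>, hence comes out of the sum.\<close>

lemma path_prob_Suc:
  fixes P :: "'a::countable \<Rightarrow> 'a \<Rightarrow> real"
  assumes P: "transition_matrix P" and chain: "markov_chain M X P"
  shows "path_prob M X A (Suc n) k =
    indicator (A (Suc n)) k * (\<integral>\<^sup>+ j. path_prob M X A n j * ennreal (P j k) \<partial>count_space UNIV)"
proof -
  have [measurable]: "\<And>t. X t \<in> measurable M (count_space UNIV)"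
    using chain by (rule markov_chain_measurable)
  \<comment> \<open>Trajectories are extensional functions on \<open>{..n}\<close>: different ones
    differ at some time \<open>t \<le> n\<close>, which makes their events disjoint, and there are
    only countably many.\<close>
  define paths where "paths j = {x \<in> PiE {..n} A. x n = j}" for j
  have cnt: "countable (paths j)" for j
    unfolding paths_def by (rule countable_Collect) (rule countable_PiE, auto)
  have step: "emeasure M {\<omega> \<in> space M. (\<forall>t\<le>n. X t \<omega> \<in> A t) \<and> X n \<omega> = j \<and> X (Suc n) \<omega> = k} =
      path_prob M X A n j * ennreal (P j k)" for j
  proof -
    \<comment> \<open>\<open>Q\<close> is later either the event of the next step or
      \<open>True\<close>; the second choice explains the conjunct \<open>True\<close> in the sums
      below.\<close>
    have split: "{\<omega> \<in> space M. (\<forall>t\<le>n. X t \<omega> \<in> A t) \<and> X n \<omega> = j \<and> Q \<omega>} =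
        (\<Union>x\<in>paths j. {\<omega> \<in> space M. (\<forall>t\<le>n. X t \<omega> = x t) \<and> Q \<omega>})" (is "?L = ?R") for Q
    proof (intro equalityI subsetI)
      fix \<omega> assume "\<omega> \<in> ?L"
      then show "\<omega> \<in> ?R"
        by (intro UN_I[of "restrict (\<lambda>t. X t \<omega>) {..n}"]) (auto simp: paths_def)
    qed (auto simp: paths_def PiE_iff)
    have disj: "disjoint_family_on (\<lambda>x. {\<omega> \<in> space M. (\<forall>t\<le>n. X t \<omega> = x t) \<and> Q \<omega>}) (paths j)" for Q
      unfolding disjoint_family_on_def paths_def by (auto intro!: PiE_ext)
    have "emeasure M {\<omega> \<in> space M. (\<forall>t\<le>n. X t \<omega> \<in> A t) \<and> X n \<omega> = j \<and> X (Suc n) \<omega> = k} =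
        (\<integral>\<^sup>+ x. emeasure M {\<omega> \<in> space M. (\<forall>t\<le>n. X t \<omega> = x t) \<and> X (Suc n) \<omega> = k} \<partial>count_space (paths j))"
      unfolding split by (intro emeasure_UN_countable disj cnt) measurable
    also have "\<dots> = (\<integral>\<^sup>+ x. emeasure M {\<omega> \<in> space M. (\<forall>t\<le>n. X t \<omega> = x t) \<and> True} * ennreal (P j k)
        \<partial>count_space (paths j))"
      by (intro nn_integral_cong) (auto simp: markov_chain_path_step[OF P chain] paths_def)
    also have "\<dots> = (\<integral>\<^sup>+ x. emeasure M {\<omega> \<in> space M. (\<forall>t\<le>n. X t \<omega> = x t) \<and> True} \<partial>count_space (paths j))
        * ennreal (P j k)"
      by (rule nn_integral_multc) simp
    also have "(\<integral>\<^sup>+ x. emeasure M {\<omega> \<in> space M. (\<forall>t\<le>n. X t \<omega> = x t) \<and> True} \<partial>count_space (paths j)) =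
        emeasure M {\<omega> \<in> space M. (\<forall>t\<le>n. X t \<omega> \<in> A t) \<and> X n \<omega> = j \<and> True}"
      unfolding split by (intro emeasure_UN_countable[symmetric] disj cnt) measurable
    finally show ?thesis by (simp add: path_prob_def)
  qed
  have "(\<integral>\<^sup>+ j. path_prob M X A n j * ennreal (P j k) \<partial>count_space UNIV) =
      emeasure M (\<Union>j. {\<omega> \<in> space M. (\<forall>t\<le>n. X t \<omega> \<in> A t) \<and> X n \<omega> = j \<and> X (Suc n) \<omega> = k})"
    unfolding step[symmetric]
    by (intro emeasure_UN_countable[symmetric]) (measurable, auto simp: disjoint_family_on_def)
  also have "(\<Union>j. {\<omega> \<in> space M. (\<forall>t\<le>n. X t \<omega> \<in> A t) \<and> X n \<omega> = j \<and> X (Suc n) \<omega> = k}) =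
      {\<omega> \<in> space M. (\<forall>t\<le>n. X t \<omega> \<in> A t) \<and> X (Suc n) \<omega> = k}"
    by auto
  finally have eq: "(\<integral>\<^sup>+ j. path_prob M X A n j * ennreal (P j k) \<partial>count_space UNIV) =
      emeasure M {\<omega> \<in> space M. (\<forall>t\<le>n. X t \<omega> \<in> A t) \<and> X (Suc n) \<omega> = k}" .
  show ?thesis
  proof (cases "k \<in> A (Suc n)")
    case True
    then show ?thesis
      unfolding eq by (auto simp: path_prob_def le_Suc_eq intro!: arg_cong[where f="emeasure M"])
  next
    case False
    then have "{\<omega> \<in> space M. (\<forall>t\<le>Suc n. X t \<omega> \<in> A t) \<and> X (Suc n) \<omega> = k} = {}"
      by auto
    then have "path_prob M X A (Suc n) k = 0"
      unfolding path_prob_def by (simp only: emeasure_empty)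
    then show ?thesis using False by simp
  qed
qed

text \<open>The recursion \<open>path_prob_Suc\<close> is linear and sees only the constraints still
  to come. Proportionality of the weights at times \<open>m\<close> and \<open>m'\<close> therefore
  persists, even for chains on different probability spaces.\<close>

lemma path_prob_shift:
  fixes P :: "'a::countable \<Rightarrow> 'a \<Rightarrow> real"
  assumes P: "transition_matrix P" and chain: "markov_chain M X P" "markov_chain M' Y P"
    and init: "\<And>k. path_prob M X A m k = c * path_prob M' Y B m' k"
    and constr: "\<And>s. A (m + Suc s) = B (m' + Suc s)"
  shows "path_prob M X A (m + n) k = c * path_prob M' Y B (m' + n) k"
proof (induction n arbitrary: k)
  case 0
  then show ?case using init by simp
next
  case (Suc n)
  show ?case
    using constr[of n]
    by (simp add: path_prob_Suc[OF P chain(1)] path_prob_Suc[OF P chain(2)] Suc.IH mult.assoc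
        nn_integral_cmult mult.left_commute)
qed

lemma emeasure_path_eq_sum:
  fixes X :: "nat \<Rightarrow> 'w \<Rightarrow> 'a::countable"
  assumes chain: "markov_chain M X P"
  shows "emeasure M {\<omega> \<in> space M. \<forall>t\<le>n. X t \<omega> \<in> A t} = (\<integral>\<^sup>+ k. path_prob M X A n k \<partial>count_space UNIV)"
proof -
  have [measurable]: "\<And>t. X t \<in> measurable M (count_space UNIV)"
    using chain by (rule markov_chain_measurable)
  have "{\<omega> \<in> space M. \<forall>t\<le>n. X t \<omega> \<in> A t} =
      (\<Union>k. {\<omega> \<in> space M. (\<forall>t\<le>n. X t \<omega> \<in> A t) \<and> X n \<omega> = k})"
    by auto
  then show ?thesis
    unfolding path_prob_def
    by (auto intro!: emeasure_UN_countable) (auto simp: disjoint_family_on_def)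
qed

lemma emeasure_path_shift:
  fixes P :: "'a::countable \<Rightarrow> 'a \<Rightarrow> real"
  assumes P: "transition_matrix P" and chain: "markov_chain M X P" "markov_chain M' Y P"
    and init: "\<And>k. path_prob M X A m k = c * path_prob M' Y B m' k"
    and constr: "\<And>s. A (m + Suc s) = B (m' + Suc s)"
  shows "emeasure M {\<omega> \<in> space M. \<forall>t\<le>m + n. X t \<omega> \<in> A t} =
    c * emeasure M' {\<omega> \<in> space M'. \<forall>t\<le>m' + n. Y t \<omega> \<in> B t}"
proof -
  have "path_prob M X A (m + n) = (\<lambda>k. c * path_prob M' Y B (m' + n) k)"
    by (intro ext path_prob_shift[OF P chain init constr])
  then show ?thesis
    by (simp add: emeasure_path_eq_sum[OF chain(1)] emeasure_path_eq_sum[OF chain(2)]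
        nn_integral_cmult)
qed

section \<open>Avoidance probabilities from the stationary start\<close>

lemma nn_integral_count_space_has_sum:
  fixes f :: "'a \<Rightarrow> real"
  assumes "(f has_sum s) A" and nonneg: "\<And>x. x \<in> A \<Longrightarrow> 0 \<le> f x"
  shows "(\<integral>\<^sup>+ x. ennreal (f x) \<partial>count_space A) = ennreal s"
proof -
  have "f summable_on A" using assms(1) by (rule has_sum_imp_summable)
  then have "Infinite_Sum.abs_summable_on f A"
    using nonneg by (simp cong: summable_on_cong)
  then have "Infinite_Set_Sum.abs_summable_on f A" by (simp only: abs_summable_equivalent)
  then show ?thesis
    using nonneg assms(1) by (simp add: nn_integral_conv_infsetsum infsetsum_infsum infsumI)
qed

text \<open>Splitting the event that the chain avoids \<open>i\<close> at the times \<open>1, \<dots>, n\<close> according to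
  whether \<open>X 0 = i\<close>; by stationarity that event is as likely as avoiding \<open>i\<close> before time \<open>n\<close>.\<close>

lemma stationary_avoidance_diff:
  fixes P :: "'a::countable \<Rightarrow> 'a \<Rightarrow> real"
  assumes P: "transition_matrix P" and \<pi>: "stationary_distribution \<pi> P"
    and X: "markov_chain M X P" and X0: "\<And>x. \<P>(\<omega> in M. X 0 \<omega> = x) = \<pi> x"
    and Y: "markov_chain M' Y P" and Y0: "AE \<omega> in M'. Y 0 \<omega> = i"
  shows "\<P>(\<omega> in M. \<forall>t<n. X t \<omega> \<noteq> i) - \<P>(\<omega> in M. \<forall>t\<le>n. X t \<omega> \<noteq> i) =
    \<pi> i * \<P>(\<omega> in M'. \<forall>t\<le>n. 0 < t \<longrightarrow> Y t \<omega> \<noteq> i)"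
proof -
  interpret M: prob_space M using X by (simp add: markov_chain_def)
  interpret M': prob_space M' using Y by (simp add: markov_chain_def)
  have [measurable]: "\<And>t. X t \<in> measurable M (count_space UNIV)"
    "\<And>t. Y t \<in> measurable M' (count_space UNIV)"
    using X Y by (auto intro: markov_chain_measurable)
  have nonneg: "0 \<le> \<pi> x" "0 \<le> P x y" for x y
    using P \<pi> by (auto simp: stationary_distribution_def transition_matrix_def)
  have X0': "emeasure M {\<omega> \<in> space M. X 0 \<omega> = x} = ennreal (\<pi> x)" for x
    by (simp add: M.emeasure_eq_measure X0)
  \<comment> \<open>\<open>A\<close> leaves the start free and forbids \<open>i\<close> afterwards;
    \<open>B\<close> in addition forces the start to be \<open>i\<close>.\<close>
  define A where "A t = (if t = 0 then UNIV else - {i})" for t :: nat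
  define B where "B t = (if t = 0 then {i} else - {i})" for t :: nat
  \<comment> \<open>For \<open>n = 0\<close> neither event restricts anything. Otherwise one step
    from \<open>\<pi>\<close> gives \<open>\<pi>\<close> again, so under \<open>A\<close> the
    weights at time 1 are \<open>\<pi>\<close> cut off at \<open>i\<close>, exactly those at time 0
    when \<open>i\<close> is forbidden from the outset; \<open>m\<close> common steps
    follow.\<close>
  have stat: "M.prob {\<omega> \<in> space M. \<forall>t\<le>n. X t \<omega> \<in> A t} = M.prob {\<omega> \<in> space M. \<forall>t<n. X t \<omega> \<noteq> i}"
  proof (cases n)
    case 0
    then show ?thesis by (simp add: A_def)
  next
    case (Suc m)
    have "emeasure M {\<omega> \<in> space M. \<forall>t\<le>1 + m. X t \<omega> \<in> A t} =
        1 * emeasure M {\<omega> \<in> space M. \<forall>t\<le>0 + m. X t \<omega> \<in> - {i}}"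
    proof (rule emeasure_path_shift[OF P X X])
      fix k
      have A0: "path_prob M X A 0 j = ennreal (\<pi> j)" for j
        by (simp add: path_prob_def A_def X0')
      have "(\<integral>\<^sup>+ j. ennreal (\<pi> j * P j k) \<partial>count_space UNIV) = ennreal (\<pi> k)"
        using \<pi> nonneg
        by (intro nn_integral_count_space_has_sum) (auto simp: stationary_distribution_def)
      then have "path_prob M X A 1 k = indicator (- {i}) k * ennreal (\<pi> k)"
        using nonneg path_prob_Suc[OF P X, of A 0 k]
        by (simp add: A0 ennreal_mult'' A_def)
      also have "\<dots> = path_prob M X (\<lambda>_. - {i}) 0 k"
      proof (cases "k = i")
        case True
        then have "{\<omega> \<in> space M. (\<forall>t\<le>0. X t \<omega> \<in> - {i}) \<and> X 0 \<omega> = k} = {}" by auto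
        then have "path_prob M X (\<lambda>_. - {i}) 0 k = 0"
          unfolding path_prob_def by (simp only: emeasure_empty)
        then show ?thesis using True by simp
      next
        case False
        then have "{\<omega> \<in> space M. (\<forall>t\<le>0. X t \<omega> \<in> - {i}) \<and> X 0 \<omega> = k} =
            {\<omega> \<in> space M. X 0 \<omega> = k}" by auto
        then have "path_prob M X (\<lambda>_. - {i}) 0 k = ennreal (\<pi> k)"
          unfolding path_prob_def by (simp only: X0')
        then show ?thesis using False by simp
      qed
      finally show "path_prob M X A 1 k = 1 * path_prob M X (\<lambda>_. - {i}) 0 k" by simp
    qed (simp add: A_def)
    then show ?thesis
      using Suc by (simp add: M.emeasure_eq_measure less_Suc_eq_le)
  qed
  \<comment> \<open>At time 0 the weights of \<open>X\<close> under \<open>B\<close> are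
    concentrated at \<open>i\<close> with mass \<open>\<pi> i\<close>. Those of \<open>Y\<close>
    under \<open>A\<close> are a unit mass at \<open>i\<close>, since \<open>Y\<close> starts there
    almost surely.\<close>
  have start: "M.prob {\<omega> \<in> space M. \<forall>t\<le>n. X t \<omega> \<in> B t} =
      \<pi> i * M'.prob {\<omega> \<in> space M'. \<forall>t\<le>n. Y t \<omega> \<in> A t}"
  proof -
    have "emeasure M {\<omega> \<in> space M. \<forall>t\<le>0 + n. X t \<omega> \<in> B t} =
        ennreal (\<pi> i) * emeasure M' {\<omega> \<in> space M'. \<forall>t\<le>0 + n. Y t \<omega> \<in> A t}"
    proof (rule emeasure_path_shift[OF P X Y])
      fix k
      show "path_prob M X B 0 k = ennreal (\<pi> i) * path_prob M' Y A 0 k"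
      proof (cases "k = i")
        case True
        have "emeasure M' {\<omega> \<in> space M'. Y 0 \<omega> = i} = 1"
          using Y0 by (intro M'.emeasure_eq_1_AE) auto
        moreover have "{\<omega> \<in> space M. X 0 \<omega> = i \<and> X 0 \<omega> = i} = {\<omega> \<in> space M. X 0 \<omega> = i}" by simp
        ultimately show ?thesis using True by (simp add: path_prob_def A_def B_def X0')
      next
        case False
        have "emeasure M' {\<omega> \<in> space M'. Y 0 \<omega> = k} = emeasure M' {}"
          by (rule emeasure_eq_AE) (use Y0 False in auto)
        moreover have "{\<omega> \<in> space M. X 0 \<omega> = i \<and> X 0 \<omega> = k} = {}" using False by auto
        then have "emeasure M {\<omega> \<in> space M. X 0 \<omega> = i \<and> X 0 \<omega> = k} = 0"
          by (simp only: emeasure_empty)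
        ultimately show ?thesis by (simp add: path_prob_def A_def B_def)
      qed
    qed (simp add: A_def B_def)
    then show ?thesis
      using nonneg by (simp add: M.emeasure_eq_measure M'.emeasure_eq_measure flip: ennreal_mult)
  qed
  have split_0: "(\<forall>t\<le>n. Q t) \<longleftrightarrow> Q 0 \<and> (\<forall>t\<le>n. 0 < t \<longrightarrow> Q t)" for Q :: "nat \<Rightarrow> bool"
    by (metis gr0I le0)
  have A_iff: "(\<forall>t\<le>n. Z t \<omega> \<in> A t) \<longleftrightarrow> (\<forall>t\<le>n. 0 < t \<longrightarrow> Z t \<omega> \<noteq> i)"
    for Z :: "nat \<Rightarrow> 'e \<Rightarrow> 'a" and \<omega>
    by (subst split_0) (simp add: A_def)
  have B_iff: "(\<forall>t\<le>n. X t \<omega> \<in> B t) \<longleftrightarrow> X 0 \<omega> = i \<and> (\<forall>t\<le>n. 0 < t \<longrightarrow> X t \<omega> \<noteq> i)" for \<omega>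
    by (subst split_0) (simp add: B_def)
  have C_iff: "(\<forall>t\<le>n. X t \<omega> \<noteq> i) \<longleftrightarrow> X 0 \<omega> \<noteq> i \<and> (\<forall>t\<le>n. 0 < t \<longrightarrow> X t \<omega> \<noteq> i)" for \<omega>
    by (rule split_0)
  have "{\<omega> \<in> space M. \<forall>t\<le>n. X t \<omega> \<in> A t} =
      {\<omega> \<in> space M. \<forall>t\<le>n. X t \<omega> \<in> B t} \<union> {\<omega> \<in> space M. \<forall>t\<le>n. X t \<omega> \<noteq> i}"
    unfolding A_iff B_iff by (subst C_iff) blast
  moreover have "{\<omega> \<in> space M. \<forall>t\<le>n. X t \<omega> \<in> B t} \<inter> {\<omega> \<in> space M. \<forall>t\<le>n. X t \<omega> \<noteq> i} = {}"
    unfolding B_iff by blast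
  ultimately have "M.prob {\<omega> \<in> space M. \<forall>t\<le>n. X t \<omega> \<in> A t} =
      M.prob {\<omega> \<in> space M. \<forall>t\<le>n. X t \<omega> \<in> B t} + M.prob {\<omega> \<in> space M. \<forall>t\<le>n. X t \<omega> \<noteq> i}"
    by (simp add: M.finite_measure_Union)
  then show ?thesis
    unfolding stat start A_iff[of Y] by simp
qed

section \<open>Laws of integer-valued times\<close>

text \<open>The inequality stays strict for the infimum because integers above \<open>n\<close> are
  at least \<open>Suc n\<close>; for empty \<open>S\<close> the infimum is infinite.\<close>

lemma less_INF_ereal_nat_iff:
  "ereal (real n) < (INF t\<in>S. ereal (real t)) \<longleftrightarrow> (\<forall>t\<in>S. n < t)"
proof
  assume "ereal (real n) < (INF t\<in>S. ereal (real t))"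
  then show "\<forall>t\<in>S. n < t" by (auto dest: less_INF_D)
next
  assume *: "\<forall>t\<in>S. n < t"
  have "ereal (real n) < ereal (real (Suc n))" by simp
  also have "\<dots> \<le> (INF t\<in>S. ereal (real t))"
    using * by (intro INF_greatest) (auto simp: Suc_le_eq simp flip: of_nat_Suc)
  finally show "ereal (real n) < (INF t\<in>S. ereal (real t))" .
qed

lemma INF_ereal_nat_cases:
  "(INF t\<in>S. ereal (real t)) \<in> insert \<infinity> (range (\<lambda>n. ereal (real n)))"
proof (cases "S = {}")
  case True
  then show ?thesis by (simp add: top_ereal_def)
next
  case False
  then have "(LEAST t. t \<in> S) \<in> S" by (auto intro: LeastI)
  then have "(INF t\<in>S. ereal (real t)) = ereal (real (LEAST t. t \<in> S))"
    by (intro INF_eqI) (auto intro: Least_le)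
  then show ?thesis by auto
qed

text \<open>Transfers properties of an infimum of random times to a variable known only through its
  law. As \<open>T\<close> is real-valued, the value \<open>\<infinity>\<close> drops out, so
  finiteness of the hitting and return times is built into the equality of laws.\<close>

lemma nat_time_law:
  fixes S :: "'w \<Rightarrow> nat set" and T :: "'d \<Rightarrow> real"
  assumes T [measurable]: "T \<in> borel_measurable N"
    and S [measurable]: "\<And>t. Measurable.pred M (\<lambda>\<omega>. t \<in> S \<omega>)"
    and law: "distr N borel (\<lambda>\<omega>. ereal (T \<omega>)) = distr M borel (\<lambda>\<omega>. INF t\<in>S \<omega>. ereal (real t))"
  shows nat_time_law_AE: "AE \<omega> in N. \<exists>n::nat. T \<omega> = real n"
    and nat_time_law_tail: "\<P>(\<omega> in N. real n < T \<omega>) = \<P>(\<omega> in M. \<forall>t\<in>S \<omega>. n < t)"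
proof -
  \<comment> \<open>The index set of the infimum must not depend on \<open>\<omega>\<close> for
    measurability of countable infima to apply; times outside \<open>S \<omega>\<close> contribute
    the neutral value \<open>\<infinity>\<close>.\<close>
  have "(\<lambda>\<omega>. INF t\<in>S \<omega>. ereal (real t)) =
      (\<lambda>\<omega>. INF t. if t \<in> S \<omega> then ereal (real t) else \<infinity>)"
  proof (intro ext antisym INF_greatest)
    fix \<omega> t assume "t \<in> S \<omega>"
    then show "(INF t. if t \<in> S \<omega> then ereal (real t) else \<infinity>) \<le> ereal (real t)"
      by (intro INF_lower2[of t]) auto
  qed (auto intro: INF_lower)
  also have "\<dots> \<in> borel_measurable M" by measurable
  finally have [measurable]: "(\<lambda>\<omega>. INF t\<in>S \<omega>. ereal (real t)) \<in> borel_measurable M" .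
  define V where "V = insert \<infinity> (range (\<lambda>n. ereal (real n)))"
  have V [measurable]: "V \<in> sets borel"
    unfolding V_def by (rule sets.countable) auto
  have "(INF t\<in>S \<omega>. ereal (real t)) \<in> V" for \<omega>
    unfolding V_def by (rule INF_ereal_nat_cases)
  then have "AE x in distr M borel (\<lambda>\<omega>. INF t\<in>S \<omega>. ereal (real t)). x \<in> V"
    using V by (subst AE_distr_iff) auto
  then have "AE \<omega> in N. ereal (T \<omega>) \<in> V"
    unfolding law[symmetric] using V by (subst (asm) AE_distr_iff) auto
  then show "AE \<omega> in N. \<exists>n::nat. T \<omega> = real n"
    by eventually_elim (auto simp: V_def)
  have "measure (distr N borel (\<lambda>\<omega>. ereal (T \<omega>))) {ereal (real n)<..} =
      measure (distr M borel (\<lambda>\<omega>. INF t\<in>S \<omega>. ereal (real t))) {ereal (real n)<..}"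
    by (simp only: law)
  then show "\<P>(\<omega> in N. real n < T \<omega>) = \<P>(\<omega> in M. \<forall>t\<in>S \<omega>. n < t)"
    by (simp add: measure_distr vimage_def less_INF_ereal_nat_iff Int_def conj_commute)
qed

section \<open>Geometric and exponential tails\<close>

text \<open>With \<open>x = 1 / (1 + p)\<close> and \<open>y = exp (- p) \<le> x\<close>, the
  assumptions on \<open>z\<close> place \<open>exp (- z)\<close> between \<open>y ^ Suc n\<close>
  and \<open>y ^ n\<close>. Each one-sided estimate comes out as \<open>p\<close> and is then
  relaxed to \<open>2 * p\<close>.\<close>

lemma inverse_power_exp_bound:
  fixes p z :: real
  assumes p: "0 < p" "p \<le> 1" and z: "real n * p \<le> z" "z \<le> real (Suc n) * p"
  shows "\<bar>(1 / (1 + p)) ^ Suc n - exp (- z)\<bar> \<le> 2 * p"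
proof -
  define x where "x = 1 / (1 + p)"
  define y where "y = exp (- p)"
  have x: "0 < x" "x \<le> 1" using p by (auto simp: x_def)
  have y: "0 < y" "y \<le> x"
    using p exp_ge_add_one_self[of p] by (auto simp: x_def y_def exp_minus field_simps)
  have y_pow: "y ^ m = exp (- (real m * p))" for m
    by (simp add: y_def flip: exp_of_nat_mult)
  have lower: "exp (- z) - x ^ Suc n \<le> 2 * p"
  proof -
    have "1 - p \<le> y" using exp_ge_add_one_self[of "-p"] by (simp add: y_def)
    \<comment> \<open>A factor \<open>1 - p \<le> exp (- p)\<close> pays for moving from
      \<open>z\<close> to \<open>z + p\<close>, which is at least
      \<open>real (Suc n) * p\<close>.\<close>
    have "exp (- z) * (1 - p) \<le> exp (- z) * y"
      using \<open>1 - p \<le> y\<close> by (intro mult_left_mono) auto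
    also have "\<dots> = exp (- z - p)" by (simp add: y_def flip: exp_add)
    also have "\<dots> \<le> y ^ Suc n"
      unfolding y_pow using z by (simp add: algebra_simps)
    also have "\<dots> \<le> x ^ Suc n" using y by (intro power_mono) auto
    finally have "exp (- z) - x ^ Suc n \<le> p * exp (- z)" by (simp add: algebra_simps)
    also have "\<dots> \<le> p * 1"
    proof (intro mult_left_mono)
      have "0 \<le> real n * p" using p by simp
      then show "exp (- z) \<le> 1" using z by simp
    qed (use p in auto)
    finally show ?thesis using p by simp
  qed
  have upper: "x ^ Suc n - exp (- z) \<le> 2 * p"
  proof -
    \<comment> \<open>The gap is of second order in \<open>p\<close>: one \<open>p\<close> becomes
      the final bound, while the other is needed to absorb the factor \<open>Suc n\<close> from the
      difference of powers.\<close>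
    have "x - y \<le> p\<^sup>2 * x"
    proof -
      have "1 - p \<le> y" using exp_ge_add_one_self[of "-p"] by (simp add: y_def)
      moreover have "x - (1 - p) = p\<^sup>2 * x"
        using p by (simp add: x_def field_simps power2_eq_square)
      ultimately show ?thesis by simp
    qed
    have "x ^ Suc n - y ^ Suc n = (x - y) * (\<Sum>j<Suc n. x ^ j * y ^ (n - j))"
      by (simp add: power_diff_sumr2 mult.commute del: sum.lessThan_Suc power_Suc)
    also have "\<dots> \<le> (x - y) * (\<Sum>j<Suc n. x ^ n)"
    proof (intro mult_left_mono sum_mono)
      fix j assume "j \<in> {..<Suc n}"
      then have "x ^ n = x ^ j * x ^ (n - j)" by (simp flip: power_add)
      then show "x ^ j * y ^ (n - j) \<le> x ^ n"
        using x y by (auto intro!: mult_left_mono power_mono)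
    qed (use y in auto)
    also have "\<dots> = (x - y) * (real (Suc n) * x ^ n)" by simp
    also have "\<dots> \<le> (p\<^sup>2 * x) * (real (Suc n) * x ^ n)"
      using \<open>x - y \<le> p\<^sup>2 * x\<close> x by (intro mult_right_mono) auto
    also have "\<dots> = p * (real (Suc n) * p * x ^ Suc n)"
      by (simp add: power2_eq_square algebra_simps)
    also have "\<dots> \<le> p * 1"
    proof (intro mult_left_mono)
      \<comment> \<open>Bernoulli's inequality makes the bound uniform in \<open>n\<close>.\<close>
      have "real (Suc n) * p \<le> (1 + p) ^ Suc n"
        using Bernoulli_inequality[of p "Suc n"] p by simp
      then show "real (Suc n) * p * x ^ Suc n \<le> 1"
        using p by (simp add: x_def power_one_over divide_simps del: power_Suc of_nat_Suc)
    qed (use p in auto)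
    finally have "x ^ Suc n - y ^ Suc n \<le> p" by simp
    moreover have "y ^ Suc n \<le> exp (- z)" unfolding y_pow using z by simp
    ultimately show ?thesis using p by simp
  qed
  show ?thesis using lower upper unfolding x_def abs_le_iff by simp
qed

text \<open>The error \<open>e n\<close> obeys \<open>(1 + p) * e (Suc n) = e n + p * h n\<close>.
  Discarding the contraction \<open>1 / (1 + p)\<close> and adding up gives the first bound; reading
  \<open>e (Suc n)\<close> as a weighted mean of \<open>e n\<close> and \<open>h n\<close> gives the
  second. They serve the two entries of the minimum.\<close>

lemma perturbed_geometric_bounds:
  fixes a h :: "nat \<Rightarrow> real"
  assumes p: "0 < p" and a0: "a 0 = 1" and rec: "\<And>n. (1 + p) * a (Suc n) = a n + p * h n"
  shows perturbed_geometric_sum_bound: "\<bar>a n - (1 / (1 + p)) ^ n\<bar> \<le> p * (\<Sum>k<n. \<bar>h k\<bar>)"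
    and perturbed_geometric_sup_bound: "(\<And>k. \<bar>h k\<bar> \<le> d) \<Longrightarrow> \<bar>a n - (1 / (1 + p)) ^ n\<bar> \<le> d"
proof -
  define e where "e n = a n - (1 / (1 + p)) ^ n" for n
  have e: "(1 + p) * e (Suc n) = e n + p * h n" for n
    using p by (simp add: e_def right_diff_distrib rec)
  have step: "(1 + p) * \<bar>e (Suc n)\<bar> \<le> \<bar>e n\<bar> + p * \<bar>h n\<bar>" for n
  proof -
    have "(1 + p) * \<bar>e (Suc n)\<bar> = \<bar>e n + p * h n\<bar>"
      using p by (simp add: abs_mult flip: e)
    also have "\<dots> \<le> \<bar>e n\<bar> + p * \<bar>h n\<bar>"
      using p abs_triangle_ineq[of "e n" "p * h n"] by (simp add: abs_mult)
    finally show ?thesis .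
  qed
  have "\<bar>e n\<bar> \<le> p * (\<Sum>k<n. \<bar>h k\<bar>)" for n
  proof (induction n)
    case 0
    then show ?case by (simp add: e_def a0)
  next
    case (Suc n)
    have "\<bar>e (Suc n)\<bar> \<le> (1 + p) * \<bar>e (Suc n)\<bar>" using p by (simp add: distrib_right)
    then show ?case using step[of n] Suc by (simp add: algebra_simps)
  qed
  then show "\<bar>a n - (1 / (1 + p)) ^ n\<bar> \<le> p * (\<Sum>k<n. \<bar>h k\<bar>)" by (simp add: e_def)
  assume h: "\<And>k. \<bar>h k\<bar> \<le> d"
  have "\<bar>e n\<bar> \<le> d" for n
  proof (induction n)
    case 0
    then show ?case using h[of 0] by (simp add: e_def a0)
  next
    case (Suc n)
    have "p * \<bar>h n\<bar> \<le> p * d" using p h by simp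
    then have "(1 + p) * \<bar>e (Suc n)\<bar> \<le> (1 + p) * d"
      using step[of n] Suc by (simp add: distrib_right)
    then show ?case using p by (simp add: mult_le_cancel_left)
  qed
  then show "\<bar>a n - (1 / (1 + p)) ^ n\<bar> \<le> d" by (simp add: e_def)
qed

text \<open>A summand is 1 exactly when \<open>k\<close> lies in \<open>{min a b..<max a b}\<close>,
  and 0 otherwise.\<close>

lemma sum_abs_diff_indicator_le:
  fixes a b :: nat
  shows "(\<Sum>k<n. \<bar>of_bool (k < a) - of_bool (k < b)\<bar> :: real) \<le> \<bar>real a - real b\<bar>"
proof -
  have "(\<Sum>k<n. \<bar>of_bool (k < a) - of_bool (k < b)\<bar> :: real) \<le>
      (\<Sum>k<n. of_bool (k \<in> {min a b..<max a b}))"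
    by (intro sum_mono) auto
  also have "\<dots> = real (card ({..<n} \<inter> {min a b..<max a b}))"
    by (simp add: of_bool_def sum.If_cases Int_def)
  also have "\<dots> \<le> real (card {min a b..<max a b})"
    by (intro of_nat_mono card_mono) auto
  also have "\<dots> = \<bar>real a - real b\<bar>" by (auto simp: min_def max_def)
  finally show ?thesis .
qed

section \<open>Exponential distribution function and coupling bounds\<close>

text \<open>The exponential density is the Erlang density with shape index 0.\<close>

lemma measure_exponential_law_atMost:
  "measure (exponential_law 1) {..z} = (if z < 0 then 0 else 1 - exp (- z))"
proof -
  have "emeasure (exponential_law 1) {..z} = ennreal (erlang_CDF 0 1 z)"
    unfolding exponential_law_def
    using emeasure_erlang_density[of 1 0 z] by simp
  then show ?thesis
    by (simp add: measure_def erlang_CDF_0)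
qed

text \<open>The absolute value moves inside the expectation for each \<open>k\<close>; the sum over
  \<open>k\<close> is then bounded pointwise by counting the integers between the two
  values.\<close>

lemma (in prob_space) sum_abs_tail_diff_le:
  fixes S T :: "'a \<Rightarrow> real"
  assumes S [measurable]: "S \<in> borel_measurable M" and T [measurable]: "T \<in> borel_measurable M"
    and S_nat: "AE \<omega> in M. \<exists>n::nat. S \<omega> = real n" and T_nat: "AE \<omega> in M. \<exists>n::nat. T \<omega> = real n"
    and int: "integrable M (\<lambda>\<omega>. S \<omega> - T \<omega>)"
  shows "(\<Sum>k<n. \<bar>\<P>(\<omega> in M. real k < S \<omega>) - \<P>(\<omega> in M. real k < T \<omega>)\<bar>) \<le> expectation (\<lambda>\<omega>. \<bar>S \<omega> - T \<omega>\<bar>)"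
proof -
  have ind: "\<P>(\<omega> in M. real k < U \<omega>) = expectation (\<lambda>\<omega>. of_bool (real k < U \<omega>) :: real)"
    "integrable M (\<lambda>\<omega>. of_bool (real k < U \<omega>) :: real)"
    if [measurable]: "U \<in> borel_measurable M" for U :: "'a \<Rightarrow> real" and k
  proof -
    have "expectation (indicator {\<omega> \<in> space M. real k < U \<omega>} :: _ \<Rightarrow> real) = expectation (\<lambda>\<omega>. of_bool (real k < U \<omega>) :: real)"
      by (intro Bochner_Integration.integral_cong) (auto simp: indicator_def)
    then show "\<P>(\<omega> in M. real k < U \<omega>) = expectation (\<lambda>\<omega>. of_bool (real k < U \<omega>) :: real)" by simp
    show "integrable M (\<lambda>\<omega>. of_bool (real k < U \<omega>) :: real)"
      by (rule integrable_const_bound[where B=1]) auto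
  qed
  have "(\<Sum>k<n. \<bar>\<P>(\<omega> in M. real k < S \<omega>) - \<P>(\<omega> in M. real k < T \<omega>)\<bar>) =
      (\<Sum>k<n. \<bar>expectation (\<lambda>\<omega>. of_bool (real k < S \<omega>) - of_bool (real k < T \<omega>))\<bar>)"
    by (simp add: ind)
  also have "\<dots> \<le> (\<Sum>k<n. expectation (\<lambda>\<omega>. \<bar>of_bool (real k < S \<omega>) - of_bool (real k < T \<omega>)\<bar>))"
    by (intro sum_mono integral_abs_bound)
  also have "\<dots> = expectation (\<lambda>\<omega>. \<Sum>k<n. \<bar>of_bool (real k < S \<omega>) - of_bool (real k < T \<omega>)\<bar>)"
    by (intro Bochner_Integration.integral_sum[symmetric] integrable_abs
        Bochner_Integration.integrable_diff ind S T)
  also have "\<dots> \<le> expectation (\<lambda>\<omega>. \<bar>S \<omega> - T \<omega>\<bar>)"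
  proof (rule integral_mono_AE)
    show "integrable M (\<lambda>\<omega>. \<Sum>k<n. \<bar>of_bool (real k < S \<omega>) - of_bool (real k < T \<omega>)\<bar> :: real)"
      by (intro Bochner_Integration.integrable_sum integrable_abs
          Bochner_Integration.integrable_diff ind S T)
    show "AE \<omega> in M. (\<Sum>k<n. \<bar>of_bool (real k < S \<omega>) - of_bool (real k < T \<omega>)\<bar>) \<le> \<bar>S \<omega> - T \<omega>\<bar>"
      using S_nat T_nat by eventually_elim (use sum_abs_diff_indicator_le in auto)
  qed (use int in auto)
  finally show ?thesis .
qed

text \<open>Coupling inequality: where the variables agree, so do the two events. The one-sided
  estimate is used in both directions.\<close>

lemma (in prob_space) abs_prob_diff_le_prob_neq:
  assumes [measurable]: "S \<in> borel_measurable M" "T \<in> borel_measurable M"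
  shows "\<bar>\<P>(\<omega> in M. x < S \<omega>) - \<P>(\<omega> in M. x < T \<omega>)\<bar> \<le> \<P>(\<omega> in M. S \<omega> \<noteq> (T \<omega> :: real))"
proof -
  have "\<P>(\<omega> in M. x < U \<omega>) \<le> \<P>(\<omega> in M. x < V \<omega>) + \<P>(\<omega> in M. U \<omega> \<noteq> V \<omega>)"
    if [measurable]: "U \<in> borel_measurable M" "V \<in> borel_measurable M" for U V :: "'a \<Rightarrow> real"
  proof -
    have "\<P>(\<omega> in M. x < U \<omega>) \<le> prob ({\<omega> \<in> space M. x < V \<omega>} \<union> {\<omega> \<in> space M. U \<omega> \<noteq> V \<omega>})"
      by (rule finite_measure_mono) auto
    also have "\<dots> \<le> \<P>(\<omega> in M. x < V \<omega>) + \<P>(\<omega> in M. U \<omega> \<noteq> V \<omega>)"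
      by (rule measure_Un_le) auto
    finally show ?thesis .
  qed
  from this[of S T] this[of T S] show ?thesis by (simp add: abs_le_iff eq_commute)
qed

text \<open>The assumption on the laws says that, for \<open>U\<close> uniform on \<open>[0, 1]\<close> and independent of \<open>S\<close>,
  the variable \<open>S + U\<close> has the equilibrium distribution of \<open>T\<close>.\<close>

lemma (in prob_space) kolmogorov_distance_exponential_le:
  fixes S T :: "'a \<Rightarrow> real"
  assumes S [measurable]: "S \<in> borel_measurable M" and T [measurable]: "T \<in> borel_measurable M"
    and S_nat: "AE \<omega> in M. \<exists>n::nat. S \<omega> = real n" and T_nat: "AE \<omega> in M. \<exists>n::nat. T \<omega> = real n"
    and p: "0 \<le> p" "p \<le> 1"
    and equilibrium: "\<And>n::nat. \<P>(\<omega> in M. S \<omega> = real n) = p * \<P>(\<omega> in M. real n < T \<omega>)"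
  shows "ennreal (kolmogorov_distance (distr M borel (\<lambda>\<omega>. p * S \<omega>)) (exponential_law 1))
    \<le> ennreal (2 * p) +
      min (ennreal p * (\<integral>\<^sup>+ \<omega>. ennreal \<bar>S \<omega> - T \<omega>\<bar> \<partial>M)) (ennreal (\<P>(\<omega> in M. S \<omega> \<noteq> T \<omega>)))"
proof -
  \<comment> \<open>The tail \<open>a\<close> is weak while those in \<open>h\<close> are strict;
    \<open>S\<close> being integer-valued, the strict tail at \<open>n\<close> is
    \<open>a (Suc n)\<close>.\<close>
  define a where "a n = \<P>(\<omega> in M. real n \<le> S \<omega>)" for n :: nat
  define h where "h n = \<P>(\<omega> in M. real n < S \<omega>) - \<P>(\<omega> in M. real n < T \<omega>)" for n :: nat
  have a_Suc: "a (Suc n) = \<P>(\<omega> in M. real n < S \<omega>)" for n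
    unfolding a_def using S_nat by (intro prob_eq_AE) (auto elim!: eventually_mono)
  have a0: "a 0 = 1"
    unfolding a_def using S_nat by (subst prob_Collect_eq_1) (auto elim!: eventually_mono)
  have diff: "a n - a (Suc n) = p * \<P>(\<omega> in M. real n < T \<omega>)" for n
  proof -
    have "{\<omega> \<in> space M. real n \<le> S \<omega>} =
        {\<omega> \<in> space M. S \<omega> = real n} \<union> {\<omega> \<in> space M. real n < S \<omega>}"
      by auto
    then have "a n = prob ({\<omega> \<in> space M. S \<omega> = real n} \<union> {\<omega> \<in> space M. real n < S \<omega>})"
      by (simp add: a_def)
    also have "\<dots> = \<P>(\<omega> in M. S \<omega> = real n) + \<P>(\<omega> in M. real n < S \<omega>)"
      by (rule finite_measure_Union) auto
    finally show ?thesis by (simp add: a_Suc equilibrium)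
  qed
  \<comment> \<open>Add \<open>p * a (Suc n)\<close>, which is \<open>p\<close> times the strict
    tail of \<open>S\<close> at \<open>n\<close>, to both sides of \<open>diff\<close>.\<close>
  have rec: "(1 + p) * a (Suc n) = a n + p * h n" for n
    using diff[of n] by (simp add: h_def algebra_simps flip: a_Suc)
  have p_pos: "0 < p"
  proof (rule ccontr)
    assume "\<not> 0 < p"
    with p have "\<P>(\<omega> in M. S \<omega> = real n) = 0" for n :: nat
      by (simp add: equilibrium)
    then have "AE \<omega> in M. S \<omega> \<noteq> real n" for n :: nat
      by (subst (asm) prob_Collect_eq_0) auto
    then have "AE \<omega> in M. \<forall>n::nat. S \<omega> \<noteq> real n" by (simp add: AE_all_countable)
    with S_nat have "AE \<omega> in M. False" by eventually_elim auto
    then show False by simp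
  qed
  \<comment> \<open>The error \<open>d\<close> is kept generic so that both bounds on the perturbed
    recursion can be inserted. For \<open>z < 0\<close> both distribution functions vanish.\<close>
  have cdf_bound: "\<bar>measure (distr M borel (\<lambda>\<omega>. p * S \<omega>)) {..z} - measure (exponential_law 1) {..z}\<bar>
      \<le> 2 * p + d" if d: "\<And>n. \<bar>a n - (1 / (1 + p)) ^ n\<bar> \<le> d" for z d
  proof (cases "z < 0")
    case True
    have "\<P>(\<omega> in M. p * S \<omega> \<le> z) = 0"
    proof (subst prob_Collect_eq_0)
      show "AE \<omega> in M. \<not> p * S \<omega> \<le> z"
        using S_nat
      proof eventually_elim
        case (elim \<omega>)
        then have "0 \<le> p * S \<omega>" using p by auto
        with True show ?case by simp
      qed
    qed auto
    moreover have "0 \<le> d" using d[of 0] by simp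
    ultimately show ?thesis
      using p True
      by (simp add: measure_distr vimage_def Int_def conj_commute measure_exponential_law_atMost)
  next
    case False
    \<comment> \<open>With this \<open>n\<close>, \<open>p * S \<omega> \<le> z\<close> means
      \<open>S \<omega> \<le> n\<close>, that is, not \<open>Suc n \<le> S \<omega>\<close>. Hence
      the exponent \<open>Suc n\<close> in the comparison with \<open>exp (- z)\<close>.\<close>
    define n where "n = nat \<lfloor>z / p\<rfloor>"
    have n: "real n \<le> z / p" "z / p < real n + 1"
      using False p_pos by (auto simp: n_def)
    have n_z: "real n * p \<le> z" "z \<le> real (Suc n) * p"
      using n p_pos by (auto simp: field_simps)
    have "\<P>(\<omega> in M. p * S \<omega> \<le> z) = \<P>(\<omega> in M. \<not> real (Suc n) \<le> S \<omega>)"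
    proof (rule prob_eq_AE)
      show "AE \<omega> in M. p * S \<omega> \<le> z \<longleftrightarrow> \<not> real (Suc n) \<le> S \<omega>"
        using S_nat
      proof eventually_elim
        case (elim \<omega>)
        then obtain m :: nat where m: "S \<omega> = real m" by auto
        have "p * S \<omega> \<le> z \<longleftrightarrow> real m \<le> z / p"
          using p_pos by (simp add: m field_simps)
        also have "\<dots> \<longleftrightarrow> m \<le> n" using n by linarith
        finally show ?case by (auto simp: m)
      qed
    qed auto
    also have "\<dots> = 1 - a (Suc n)" unfolding a_def by (rule prob_neg) auto
    finally have "measure (distr M borel (\<lambda>\<omega>. p * S \<omega>)) {..z} = 1 - a (Suc n)"
      by (simp add: measure_distr vimage_def Int_def conj_commute)
    then show ?thesis
      using False d[of "Suc n"] inverse_power_exp_bound[OF p_pos p(2) n_z]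
      by (simp add: measure_exponential_law_atMost del: power_Suc)
  qed
  have bound: "ennreal (kolmogorov_distance (distr M borel (\<lambda>\<omega>. p * S \<omega>)) (exponential_law 1))
      \<le> ennreal (2 * p) + ennreal d" if d: "\<And>n. \<bar>a n - (1 / (1 + p)) ^ n\<bar> \<le> d" for d
  proof -
    have "0 \<le> d" using d[of 0] by simp
    moreover have "kolmogorov_distance (distr M borel (\<lambda>\<omega>. p * S \<omega>)) (exponential_law 1) \<le> 2 * p + d"
      unfolding kolmogorov_distance_def using cdf_bound[OF d] by (intro cSUP_least) auto
    ultimately show ?thesis
      using p by (simp add: ennreal_leI flip: ennreal_plus)
  qed
  have neq: "ennreal (kolmogorov_distance (distr M borel (\<lambda>\<omega>. p * S \<omega>)) (exponential_law 1))
      \<le> ennreal (2 * p) + ennreal (\<P>(\<omega> in M. S \<omega> \<noteq> T \<omega>))"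
  proof (rule bound, rule perturbed_geometric_sup_bound[OF p_pos a0 rec])
    show "\<bar>h k\<bar> \<le> \<P>(\<omega> in M. S \<omega> \<noteq> T \<omega>)" for k
      unfolding h_def by (rule abs_prob_diff_le_prob_neq) auto
  qed
  have mean: "ennreal (kolmogorov_distance (distr M borel (\<lambda>\<omega>. p * S \<omega>)) (exponential_law 1))
      \<le> ennreal (2 * p) + ennreal p * (\<integral>\<^sup>+ \<omega>. ennreal \<bar>S \<omega> - T \<omega>\<bar> \<partial>M)"
  \<comment> \<open>Positivity of \<open>p\<close> matters for an infinite mean: in
    \<open>ennreal\<close> the product of 0 and \<open>\<infinity>\<close> is 0, whereas here the
    right-hand side is infinite.\<close>
  proof (cases "(\<integral>\<^sup>+ \<omega>. ennreal \<bar>S \<omega> - T \<omega>\<bar> \<partial>M) = \<infinity>")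
    case True
    then show ?thesis using p_pos by (simp add: ennreal_mult_top)
  next
    case False
    then have int: "integrable M (\<lambda>\<omega>. S \<omega> - T \<omega>)"
      by (intro integrableI_bounded) (auto simp: less_top)
    have "ennreal (kolmogorov_distance (distr M borel (\<lambda>\<omega>. p * S \<omega>)) (exponential_law 1))
        \<le> ennreal (2 * p) + ennreal (p * expectation (\<lambda>\<omega>. \<bar>S \<omega> - T \<omega>\<bar>))"
    proof (rule bound)
      fix n
      have "(\<Sum>k<n. \<bar>h k\<bar>) \<le> expectation (\<lambda>\<omega>. \<bar>S \<omega> - T \<omega>\<bar>)"
        unfolding h_def by (rule sum_abs_tail_diff_le[OF S T S_nat T_nat int])
      then have "p * (\<Sum>k<n. \<bar>h k\<bar>) \<le> p * expectation (\<lambda>\<omega>. \<bar>S \<omega> - T \<omega>\<bar>)"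
        using p by (intro mult_left_mono)
      with perturbed_geometric_sum_bound[OF p_pos a0 rec, of n]
      show "\<bar>a n - (1 / (1 + p)) ^ n\<bar> \<le> p * expectation (\<lambda>\<omega>. \<bar>S \<omega> - T \<omega>\<bar>)" by simp
    qed
    also have "ennreal (p * expectation (\<lambda>\<omega>. \<bar>S \<omega> - T \<omega>\<bar>)) =
        ennreal p * (\<integral>\<^sup>+ \<omega>. ennreal \<bar>S \<omega> - T \<omega>\<bar> \<partial>M)"
      using p int by (simp add: ennreal_mult nn_integral_eq_integral)
    finally show ?thesis .
  qed
  show ?thesis using neq mean by (simp add: min_def)
qed

section \<open>Application to hitting and return times\<close>

theorem corollary3p2:
  fixes P :: "'a::countable \<Rightarrow> 'a \<Rightarrow> real" and \<pi> :: "'a \<Rightarrow> real" and i :: 'a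
    and M :: "'b measure" and X :: "nat \<Rightarrow> 'b \<Rightarrow> 'a"
    and M' :: "'c measure" and Y :: "nat \<Rightarrow> 'c \<Rightarrow> 'a"
    and N :: "'d measure" and T_pi T_i :: "'d \<Rightarrow> real"
  assumes "transition_matrix P"
    and "ergodic_chain P"
    and "stationary_distribution \<pi> P"
    and "markov_chain M X P" and "\<And>x. \<P>(\<omega> in M. X 0 \<omega> = x) = \<pi> x"
    and "markov_chain M' Y P" and "AE \<omega> in M'. Y 0 \<omega> = i"
    and "prob_space N"
    and "T_pi \<in> borel_measurable N" and "T_i \<in> borel_measurable N"
    and "distr N borel (\<lambda>\<omega>. ereal (T_pi \<omega>)) = distr M borel (hitting_time X i)"
    and "distr N borel (\<lambda>\<omega>. ereal (T_i \<omega>)) = distr M' borel (return_time Y i)"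
  shows "ennreal (kolmogorov_distance (distr N borel (\<lambda>\<omega>. \<pi> i * T_pi \<omega>)) (exponential_law 1))
    \<le> ennreal (2 * \<pi> i) +
      min (ennreal (\<pi> i) * (\<integral>\<^sup>+ \<omega>. ennreal \<bar>T_pi \<omega> - T_i \<omega>\<bar> \<partial>N))
          (ennreal (\<P>(\<omega> in N. T_pi \<omega> \<noteq> T_i \<omega>)))"
proof -
  interpret M: prob_space M using assms(4) by (simp add: markov_chain_def)
  interpret N: prob_space N by fact
  have [measurable]: "\<And>t. X t \<in> measurable M (count_space UNIV)"
    "\<And>t. Y t \<in> measurable M' (count_space UNIV)"
    using assms(4,6) by (auto intro: markov_chain_measurable)
  have pred_X: "Measurable.pred M (\<lambda>\<omega>. t \<in> {t. X t \<omega> = i})" for t by simp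
  have pred_Y: "Measurable.pred M' (\<lambda>\<omega>. t \<in> {t. 0 < t \<and> Y t \<omega> = i})" for t by simp
  note T_pi_law = nat_time_law[OF assms(9) pred_X assms(11)[unfolded hitting_time_def[abs_def]]]
  note T_i_law = nat_time_law[OF assms(10) pred_Y assms(12)[unfolded return_time_def[abs_def]]]
  have T_pi_tail: "\<P>(\<omega> in N. real n < T_pi \<omega>) = \<P>(\<omega> in M. \<forall>t\<le>n. X t \<omega> \<noteq> i)" for n
  proof -
    have "(\<forall>t\<in>{t. X t \<omega> = i}. n < t) \<longleftrightarrow> (\<forall>t\<le>n. X t \<omega> \<noteq> i)" for \<omega>
      by (metis (mono_tags) mem_Collect_eq not_le)
    then show ?thesis using T_pi_law(2)[of n] by simp
  qed
  have T_i_tail: "\<P>(\<omega> in N. real n < T_i \<omega>) = \<P>(\<omega> in M'. \<forall>t\<le>n. 0 < t \<longrightarrow> Y t \<omega> \<noteq> i)" for n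
  proof -
    have "(\<forall>t\<in>{t. 0 < t \<and> Y t \<omega> = i}. n < t) \<longleftrightarrow> (\<forall>t\<le>n. 0 < t \<longrightarrow> Y t \<omega> \<noteq> i)" for \<omega>
      by (metis (mono_tags) mem_Collect_eq not_le)
    then show ?thesis using T_i_law(2)[of n] by simp
  qed
  \<comment> \<open>A point mass is a difference of weak and strict tails; for \<open>n = 0\<close>
    avoidance before time \<open>n\<close> is vacuous, matching the almost sure nonnegativity of
    \<open>T_pi\<close>.\<close>
  have T_pi_point: "\<P>(\<omega> in N. T_pi \<omega> = real n) =
      \<P>(\<omega> in M. \<forall>t<n. X t \<omega> \<noteq> i) - \<P>(\<omega> in M. \<forall>t\<le>n. X t \<omega> \<noteq> i)" for n
  proof -
    have "\<P>(\<omega> in M. \<forall>t<n. X t \<omega> \<noteq> i) = \<P>(\<omega> in N. real n \<le> T_pi \<omega>)"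
    proof (cases n)
      case 0
      have "\<P>(\<omega> in N. 0 \<le> T_pi \<omega>) = 1"
        using T_pi_law(1) assms(9) by (subst N.prob_Collect_eq_1) (auto elim!: eventually_mono)
      then show ?thesis using 0 by (simp add: M.prob_space)
    next
      case (Suc m)
      have "\<P>(\<omega> in N. real m < T_pi \<omega>) = \<P>(\<omega> in N. real n \<le> T_pi \<omega>)"
        using T_pi_law(1) assms(9) Suc by (intro N.prob_eq_AE) (auto elim!: eventually_mono)
      then show ?thesis using Suc by (simp add: T_pi_tail less_Suc_eq_le)
    qed
    also have "{\<omega> \<in> space N. real n \<le> T_pi \<omega>} =
        {\<omega> \<in> space N. T_pi \<omega> = real n} \<union> {\<omega> \<in> space N. real n < T_pi \<omega>}"
      by auto
    also have "N.prob \<dots> = \<P>(\<omega> in N. T_pi \<omega> = real n) + \<P>(\<omega> in N. real n < T_pi \<omega>)"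
      using assms(9) by (intro N.finite_measure_Union) auto
    finally show ?thesis by (simp add: T_pi_tail)
  qed
  show ?thesis
  proof (rule N.kolmogorov_distance_exponential_le[OF assms(9,10) T_pi_law(1) T_i_law(1)])
    show "0 \<le> \<pi> i" "\<pi> i \<le> 1"
      using M.prob_le_1 by (simp_all flip: assms(5))
    \<comment> \<open>Stationarity enters here: both sides are now avoidance probabilities of the
      two chains. The joint law of \<open>T_pi\<close> and \<open>T_i\<close> is not involved, only
      their marginals.\<close>
    show "\<P>(\<omega> in N. T_pi \<omega> = real n) = \<pi> i * \<P>(\<omega> in N. real n < T_i \<omega>)" for n
      unfolding T_pi_point T_i_tail by (rule stationary_avoidance_diff[OF assms(1,3-7)])
  qed
qed

end
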